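(* Let $n\ge1$. For every lattice path $\pi\in\mathcal L_{n,n}$ we have $\operatorname{sw}(\pi)=\zeta_C(\pi)$. In particular, the sweep map $\operatorname{sw}:\mathcal L_{n,n}\to\mathcal B_n$ is a bijection.
   Context: $\mathcal L_{n,n}$: lattice paths from $(0,0)$ to $(n,n)$ with steps $N=(0,1)$, $E=(1,0)$; $\mathcal B_n$: lattice paths from $(0,0)$ with $2n$ steps in $\{N,E\}$ never going below $x=y$. Sweep map: for $\pi=s_1s_2\cdots s_{2n}$, assign labels $\ell(s_1)=0$, $\ell(s_{i+1})=\ell(s_i)+2n+1$ if $s_i=N$ and $\ell(s_{i+1})=\ell(s_i)-2n$ if $s_i=E$. Form a collection $X$ of $2n$ labelled steps: for each $i$ with $\ell(s_i)<0$ include $(s_i,\ell(s_i))$; for each $i$ with $\ell(s_i)>0$ include $(s_{i-1},-\ell(s_i))$; and for $s_1$ (the only step labelled $0$) include $(s_{2n},-n)$. Then $\operatorname{sw}(\pi)$ is the path obtained by drawing the steps of $X$ in order of increasing label. Type $C$ area vector of $\pi$: $a_i=i-b_i$, $b_i$ the $x$-coordinate of the $i$-th North step. $\zeta_C(\pi)$: start at $(0,0)$ with $i=n$; read the area vector left to right drawing $E$ for each entry $-i-1$ and $N$ for each entry $-i$, then right to left drawing $E$ for each entry $i+1$ and $N$ for each entry $i$; decrease $i$ by $1$ and repeat, stopping once $2n$ steps are drawn. *)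

theory Defs
  imports Main "HOL-Library.Product_Plus" "HOL-Library.While_Combinator"
begin

datatype step = North | East

text \<open>A lattice path starting at \<open>(0,0)\<close> is its list of steps. Lists are indexed from 0, so
  \<open>p ! k\<close> is the step \<open>s\<^bsub>k+1\<^esub>\<close> of \<open>p = s\<^sub>1 s\<^sub>2 \<dots>\<close>.\<close>

type_synonym path = "step list"

fun step_vec :: "step \<Rightarrow> nat \<times> nat" where
  "step_vec North = (0, 1)"
| "step_vec East = (1, 0)"

definition position :: "path \<Rightarrow> nat \<Rightarrow> nat \<times> nat" where
  "position p k = sum_list (map step_vec (take k p))"

definition square_paths :: "nat \<Rightarrow> path set" where
  "square_paths n = {p. position p (length p) = (n, n)}"

definition ballot_paths :: "nat \<Rightarrow> path set" where
  "ballot_paths n =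
     {p. length p = 2 * n \<and> (\<forall>k\<le>2 * n. fst (position p k) \<le> snd (position p k))}"

text \<open>\<open>sweep_label n p k\<close> is the label of the step \<open>p ! k\<close>.\<close>

primrec sweep_label :: "nat \<Rightarrow> path \<Rightarrow> nat \<Rightarrow> int" where
  "sweep_label n p 0 = 0"
| "sweep_label n p (Suc k) =
     (case p ! k of
        North \<Rightarrow> sweep_label n p k + (2 * int n + 1)
      | East \<Rightarrow> sweep_label n p k - 2 * int n)"

text \<open>The last branch applies to the first step only, since on paths from \<open>(0,0)\<close> to \<open>(n,n)\<close>
  no other step has label 0.\<close>

definition sweep_entry :: "nat \<Rightarrow> path \<Rightarrow> nat \<Rightarrow> step \<times> int" where
  "sweep_entry n p k =
     (if sweep_label n p k < 0 then (p ! k, sweep_label n p k)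
      else if sweep_label n p k > 0 then (p ! (k - 1), - sweep_label n p k)
      else (p ! (2 * n - 1), - int n))"

text \<open>For a path from \<open>(0,0)\<close> to \<open>(n,n)\<close> the labels of the collection are pairwise distinct,
  so sorting by label involves no choice.\<close>

definition sw :: "nat \<Rightarrow> path \<Rightarrow> path" where
  "sw n p = map fst (sort_key snd (map (sweep_entry n p) [0..<2 * n]))"

definition north_indices :: "path \<Rightarrow> nat list" where
  "north_indices p = filter (\<lambda>k. p ! k = North) [0..<length p]"

text \<open>Here \<open>i\<close> runs from 1 to \<open>n\<close>; \<open>north_indices p ! (i - 1)\<close> locates the \<open>i\<close>-th North step.\<close>

definition area_vector :: "nat \<Rightarrow> path \<Rightarrow> int list" where
  "area_vector n p =
     map (\<lambda>i. int i - int (fst (position p (north_indices p ! (i - 1))))) [1..<Suc n]"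

fun zeta_scan :: "int \<Rightarrow> int \<Rightarrow> int list \<Rightarrow> path" where
  "zeta_scan e m [] = []"
| "zeta_scan e m (x # xs) =
     (if x = e then [East] else if x = m then [North] else []) @ zeta_scan e m xs"

definition zeta_round :: "int list \<Rightarrow> int \<Rightarrow> path" where
  "zeta_round a i = zeta_scan (- i - 1) (- i) a @ zeta_scan (i + 1) i (rev a)"

text \<open>The outer \<open>take\<close> makes the procedure stop as soon as \<open>2n\<close> steps are drawn, even if this
  happened in the middle of a round. An entry 0 of the area vector is drawn as a North step in both
  scans of the round \<open>i = 0\<close>.\<close>

definition zeta_C :: "nat \<Rightarrow> path \<Rightarrow> path" where
  "zeta_C n p =
     take (2 * n) (snd (while (\<lambda>(i, w). length w < 2 * n)
                              (\<lambda>(i, w). (i - 1, w @ zeta_round (area_vector n p) i))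
                              (int n, [])))"

end

theory Submission
  imports Defs "HOL-Library.Multiset"
begin

text \<open>
  Since the label of a step leaving \<open>(x, y)\<close> is \<open>2n(y - x) + y\<close> with \<open>0 \<le> y \<le> n\<close>, sorting by
  label groups the steps by the height \<open>y - x\<close> of a vertex: for \<open>i = n, \<dots>, 0\<close> one reads the steps
  leaving height \<open>-i - 1\<close> from left to right and then the steps entering height \<open>i\<close> from right to
  left. Matching each East step with the North step crossing the same pair of heights identifies
  these words with the rounds of the zeta map.

  For the bijection, let \<open>u(h)\<close> be the number of North steps from height \<open>h\<close> to \<open>h + 1\<close>, which is also
  the number of East steps from \<open>h + 1\<close> to \<open>h\<close>. The word of round \<open>i\<close> starts at height
  \<open>u(i) + u(-i - 2)\<close> and has as many East steps, so the image is a ballot path. Conversely the image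
  ends at height \<open>2 u(-1)\<close>, and reading it from right to left each block is the longest suffix with a
  number of North steps already known, as every earlier block is empty or ends with North. Hence
  the blocks, and then the path, can be recovered. Surjectivity follows by counting.
\<close>

section \<open>Heights along a path and the words read at each level\<close>

fun rise :: "step \<Rightarrow> int" where
  "rise North = 1"
| "rise East = -1"

definition height :: "path \<Rightarrow> int" where
  "height p = sum_list (map rise p)"

lemma height_simps [simp]:
  "height [] = 0" "height (s # p) = rise s + height p" "height (p @ q) = height p + height q"
  by (simp_all add: height_def)

lemma height_count: "height p = int (count_list p North) - int (count_list p East)"
proof (induction p)
  case (Cons s p)
  then show ?case by (cases s) auto
qed simp

lemma length_count: "length p = count_list p North + count_list p East"
proof (induction p)
  case (Cons s p)
  then show ?case by (cases s) auto
qed simp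

lemma position_eq: "position p k = (count_list (take k p) East, count_list (take k p) North)"
proof -
  have "sum_list (map step_vec q) = (count_list q East, count_list q North)" for q
  proof (induction q)
    case (Cons s q)
    then show ?case by (cases s) auto
  qed (simp add: zero_prod_def)
  then show ?thesis by (simp add: position_def)
qed

lemma square_paths_iff: "p \<in> square_paths n \<longleftrightarrow> length p = 2 * n \<and> height p = 0"
  using length_count[of p] by (auto simp: square_paths_def position_eq height_count)

fun outs :: "int \<Rightarrow> int \<Rightarrow> path \<Rightarrow> path" where
  "outs c h [] = []"
| "outs c h (s # p) = (if c = h then [s] else []) @ outs (c + rise s) h p"

fun ins :: "int \<Rightarrow> int \<Rightarrow> path \<Rightarrow> path" where
  "ins c h [] = []"
| "ins c h (s # p) = (if c + rise s = h then [s] else []) @ ins (c + rise s) h p"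

lemma outs_eq_filter:
  "map ((!) p) (filter (\<lambda>k. c + height (take k p) = h) [0..<length p]) = outs c h p"
proof (induction p arbitrary: c)
  case (Cons s p)
  have "[0..<length (s # p)] = 0 # map Suc [0..<length p]"
    by (simp add: map_Suc_upt upt_conv_Cons del: upt_Suc)
  then show ?case
    by (simp add: Cons[symmetric] filter_map o_def add.assoc del: upt_Suc)
qed simp

lemma ins_eq_filter:
  "map ((!) p) (filter (\<lambda>k. c + height (take (Suc k) p) = h) [0..<length p]) = ins c h p"
proof (induction p arbitrary: c)
  case (Cons s p)
  have "[0..<length (s # p)] = 0 # map Suc [0..<length p]"
    by (simp add: map_Suc_upt upt_conv_Cons del: upt_Suc)
  then show ?case
    by (simp add: Cons[symmetric] filter_map o_def add.assoc del: upt_Suc)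
qed simp

definition level_word :: "path \<Rightarrow> nat \<Rightarrow> path" where
  "level_word p i = outs 0 (- int i - 1) p @ rev (ins 0 (int i) p)"

text \<open>Both bounds vary: \<open>m\<close> in inductions over the rounds, \<open>i\<close> when
  the innermost levels are peeled off on the right.\<close>

definition level_words :: "path \<Rightarrow> nat \<Rightarrow> nat \<Rightarrow> path" where
  "level_words p i m = concat (map (level_word p) (rev [i..<m]))"

section \<open>The sweep map by levels\<close>

lemma sweep_label_eq:
  "k \<le> length p \<Longrightarrow>
     sweep_label n p k = 2 * int n * height (take k p) + int (count_list (take k p) North)"
proof (induction k)
  case (Suc k)
  then show ?case by (cases "p ! k") (auto simp: take_Suc_conv_app_nth algebra_simps)
qed simp

text \<open>It suffices to exhibit an enumeration \<open>ks\<close> of the vertices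
  \<open>1..2n\<close> along which the keys strictly increase, as sorting by distinct keys has only
  one result.\<close>

lemma sw_eq_level_words:
  assumes n: "n \<ge> 1" and p: "p \<in> square_paths n"
  shows "sw n p = level_words p 0 (Suc n)"
proof -
  define H where "H k = height (take k p)" for k
  define y where "y k = int (count_list (take k p) North)" for k
  define key where
    "key k = (if H k < 0 then 2 * int n * H k + y k else - (2 * int n * H k + y k))" for k
  \<comment> \<open>A vertex below the diagonal contributes the step leaving it, any other the step
    entering it.\<close>
  define e where "e k = (if H k < 0 then p ! k else p ! (k - 1), key k)" for k
  define neg where "neg i = filter (\<lambda>k. H k = - int i - 1) [1..<Suc (2 * n)]" for i
  define pos where "pos i = rev (filter (\<lambda>k. H k = int i) [1..<Suc (2 * n)])" for i
  define ks where "ks m = concat (map (\<lambda>i. neg i @ pos i) (rev [0..<m]))" for m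
  have len: "length p = 2 * n" and ht: "height p = 0"
    using p by (auto simp: square_paths_iff)
  have cN: "count_list p North = n" and cE: "count_list p East = n"
    using len ht length_count[of p] by (auto simp: height_count)
  \<comment> \<open>This is \<open>k = x + y\<close> with \<open>x = y - H k\<close>; at a fixed
    height, \<open>y\<close> grows with the index.\<close>
  have idx: "int k = 2 * y k - H k" and y0: "0 \<le> y k" "y k \<le> int n"
    and x0: "H k \<le> y k" "y k \<le> H k + int n" if "k \<le> 2 * n" for k
  proof -
    have le: "count_list (take k p) s \<le> count_list p s" for s
      using count_list_append[of "take k p" "drop k p" s] by simp
    show "int k = 2 * y k - H k"
      using that len length_count[of "take k p"] by (simp add: y_def H_def height_count)
    show "0 \<le> y k" "y k \<le> int n" "H k \<le> y k" "y k \<le> H k + int n"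
      using le[of North] le[of East] cN cE by (auto simp: y_def H_def height_count)
  qed
  have H_ends: "H 0 = 0" "H (2 * n) = 0" and y_end: "y (2 * n) = int n"
    using len ht cN by (auto simp: H_def y_def)
  have label: "sweep_label n p k = 2 * int n * H k + y k" if "k \<le> 2 * n" for k
    using that len by (simp add: sweep_label_eq H_def y_def)
  have label_neg: "2 * int n * H k + y k < 0" if "k \<le> 2 * n" "H k < 0" for k
  proof -
    have "int n * H k \<le> int n * (-1)" using that by (intro mult_left_mono) auto
    then show ?thesis using y0[OF that(1)] n by linarith
  qed
  have label_pos: "2 * int n * H k + y k > 0" if "1 \<le> k" "k \<le> 2 * n" "0 \<le> H k" for k
  proof -
    have "0 \<le> int n * H k" using that by simp
    moreover have "y k > 0" using idx[of k] that by linarith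
    ultimately show ?thesis by linarith
  qed
  have entry: "sweep_entry n p k = e k" if "1 \<le> k" "k < 2 * n" for k
    using label[of k] label_neg[of k] label_pos[of k] that
    by (auto simp: sweep_entry_def e_def key_def)
  \<comment> \<open>The special entry of the first step is the regular entry of the endpoint \<open>(n, n)\<close>.\<close>
  have entry0: "sweep_entry n p 0 = e (2 * n)"
    by (simp add: sweep_entry_def e_def key_def H_ends y_end)
  have "[0..<2 * n] = 0 # [1..<2 * n]" using n by (simp add: upt_conv_Cons)
  then have "map (sweep_entry n p) [0..<2 * n] = e (2 * n) # map e [1..<2 * n]"
    using entry entry0 by simp
  moreover have "[1..<Suc (2 * n)] = [1..<2 * n] @ [2 * n]" using n by simp
  ultimately have entries: "mset (map (sweep_entry n p) [0..<2 * n]) = mset (map e [1..<Suc (2 * n)])"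
    by simp
  have key_neg: "key k = y k - 2 * int n * int i - 2 * int n" "1 \<le> k" "k \<le> 2 * n" "H k = - int i - 1"
    if "k \<in> set (neg i)" for k i
  proof -
    show H: "H k = - int i - 1" and "1 \<le> k" "k \<le> 2 * n"
      using that by (auto simp: neg_def simp del: upt_Suc)
    show "key k = y k - 2 * int n * int i - 2 * int n" unfolding key_def H by (simp add: algebra_simps)
  qed
  have key_pos: "key k = - y k - 2 * int n * int i" "1 \<le> k" "k \<le> 2 * n" "H k = int i"
    if "k \<in> set (pos i)" for k i
  proof -
    show H: "H k = int i" and "1 \<le> k" "k \<le> 2 * n"
      using that by (auto simp: pos_def simp del: upt_Suc)
    show "key k = - y k - 2 * int n * int i" unfolding key_def H by (simp add: algebra_simps)
  qed
  have sorted: "sorted_wrt (\<lambda>k l. key k < key l) (ks m) \<and> (\<forall>k\<in>set (ks m). key k \<ge> - 2 * int n * int m)" for m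
  proof (induction m)
    case (Suc m)
    have ks_Suc: "ks (Suc m) = neg m @ pos m @ ks m" by (simp add: ks_def)
    have 1: "sorted_wrt (\<lambda>k l. key k < key l) (neg m)"
    proof (rule sorted_wrt_mono_rel[of _ "(<)"])
      show "sorted_wrt (<) (neg m)" unfolding neg_def by (intro sorted_wrt_filter) (simp del: upt_Suc)
      show "key k < key l" if "k \<in> set (neg m)" "l \<in> set (neg m)" "k < l" for k l
        using key_neg[OF that(1)] key_neg[OF that(2)] idx[of k] idx[of l] that(3) by linarith
    qed
    have 2: "sorted_wrt (\<lambda>k l. key k < key l) (pos m)"
    proof (rule sorted_wrt_mono_rel[of _ "(>)"])
      show "sorted_wrt (>) (pos m)" unfolding pos_def sorted_wrt_rev by (intro sorted_wrt_filter) (simp del: upt_Suc)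
      show "key k < key l" if "k \<in> set (pos m)" "l \<in> set (pos m)" "k > l" for k l
        using key_pos[OF that(1)] key_pos[OF that(2)] idx[of k] idx[of l] that(3) by linarith
    qed
    \<comment> \<open>The keys of \<open>neg m\<close>, \<open>pos m\<close>, \<open>ks m\<close>
      lie in successive ranges cut at \<open>- 2nm - n\<close> and \<open>- 2nm\<close>. Strictness
      at the second cut is shown for \<open>m > 0\<close> only; \<open>ks 0\<close> is
      empty.\<close>
    have 3: "key k < - 2 * int n * int m - int n" "key k \<ge> - 2 * int n * int (Suc m)"
      if "k \<in> set (neg m)" for k
      using key_neg[OF that] y0[of k] x0[of k] by (auto simp: algebra_simps)
    have 4: "key k \<ge> - 2 * int n * int m - int n" "key k \<le> - 2 * int n * int m"
      "m > 0 \<Longrightarrow> key k < - 2 * int n * int m" if "k \<in> set (pos m)" for k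
      using key_pos[OF that] y0[of k] x0[of k] by (auto simp: algebra_simps)
    have 5: "ks m = []" if "m = 0" using that by (simp add: ks_def)
    have 6: "- 2 * int n * int (Suc m) \<le> - 2 * int n * int m - int n" by (simp add: algebra_simps)
    have 7: "key k \<ge> - 2 * int n * int m" if "k \<in> set (ks m)" for k using Suc that by blast
    have 8: "key k < key l" if "k \<in> set (pos m)" "l \<in> set (ks m)" for k l
      using 4[OF that(1)] 7[OF that(2)] 5 that(2) by (cases "m = 0") auto
    have 9: "key k < key l" if "k \<in> set (neg m)" "l \<in> set (pos m) \<union> set (ks m)" for k l
      using 3[OF that(1)] 4[of l] 7[of l] that(2) by force
    have 10: "key k \<ge> - 2 * int n * int (Suc m)" if "k \<in> set (ks (Suc m))" for k
      using that 3[of k] 4[of k] 7[of k] 6 unfolding ks_Suc by force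
    show ?case using 1 2 8 9 10 Suc by (auto simp: ks_Suc sorted_wrt_append)
  qed (simp add: ks_def)
  have "set (ks (Suc n)) = {1..2 * n}"
  proof (intro set_eqI iffI)
    fix k assume k: "k \<in> {1..2 * n}"
    define i where "i = nat (if H k < 0 then - H k - 1 else H k)"
    have "i < Suc n" using k x0[of k] y0[of k] by (auto simp: i_def)
    moreover have "k \<in> set (neg i @ pos i)"
      using k by (cases "H k < 0") (auto simp: neg_def pos_def i_def simp del: upt_Suc)
    ultimately show "k \<in> set (ks (Suc n))" unfolding ks_def by (auto simp del: upt_Suc)
  qed (auto simp: ks_def neg_def pos_def simp del: upt_Suc)
  moreover have "distinct (ks (Suc n))"
  proof -
    have "sorted_wrt (<) (map key (ks (Suc n)))"
      using sorted[of "Suc n"] by (simp add: sorted_wrt_map)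
    then show ?thesis by (auto simp: strict_sorted_iff distinct_map)
  qed
  ultimately have "mset (ks (Suc n)) = mset [1..<Suc (2 * n)]"
    using set_eq_iff_mset_eq_distinct[of "ks (Suc n)" "[1..<Suc (2 * n)]"]
    by (simp add: atLeastLessThanSuc_atLeastAtMost del: upt_Suc)
  then have perm: "mset (map (sweep_entry n p) [0..<2 * n]) = mset (map e (ks (Suc n)))"
    unfolding entries by (simp only: mset_map)
  have sorted': "sorted_wrt (<) (map snd (map e (ks (Suc n))))"
    using sorted[of "Suc n"] by (simp add: sorted_wrt_map e_def)
  have "sort_key snd (map (sweep_entry n p) [0..<2 * n]) = map e (ks (Suc n))"
  proof (rule sort_key_inj_key_eq[OF perm])
    have "distinct (map snd (map e (ks (Suc n))))"
      using sorted' by (rule strict_sorted_iff[THEN iffD1, THEN conjunct2])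
    then show "inj_on snd (set (map (sweep_entry n p) [0..<2 * n]))"
      using mset_eq_setD[OF perm] by (metis distinct_map)
    show "sorted (map snd (map e (ks (Suc n))))"
      using sorted' by (rule strict_sorted_iff[THEN iffD1, THEN conjunct1])
  qed
  then have sw: "sw n p = map (fst \<circ> e) (ks (Suc n))" by (simp add: sw_def)
  have "map (fst \<circ> e) (neg i) = outs 0 (- int i - 1) p" for i
  proof -
    \<comment> \<open>The range moves from \<open>1..2n\<close> to \<open>0..2n - 1\<close>; the
      vertices exchanged have height 0, never \<open>- i - 1\<close>.\<close>
    have "neg i = filter (\<lambda>k. H k = - int i - 1) [0..<Suc (2 * n)]"
      unfolding neg_def by (subst (2) upt_conv_Cons) (auto simp: H_ends simp del: upt_Suc)
    also have "\<dots> = filter (\<lambda>k. 0 + height (take k p) = - int i - 1) [0..<length p]"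
      using H_ends by (simp add: len H_def)
    finally have "map ((!) p) (neg i) = outs 0 (- int i - 1) p" by (simp only: outs_eq_filter)
    moreover have "map (fst \<circ> e) (neg i) = map ((!) p) (neg i)"
      by (auto simp: neg_def e_def simp del: upt_Suc)
    ultimately show ?thesis by simp
  qed
  moreover have "map (fst \<circ> e) (pos i) = rev (ins 0 (int i) p)" for i
  proof -
    have "rev (pos i) = map Suc (filter (\<lambda>k. H (Suc k) = int i) [0..<2 * n])"
      by (simp add: pos_def filter_map o_def map_Suc_upt[symmetric] del: upt_Suc)
    then have "map (fst \<circ> e) (rev (pos i))
        = map ((!) p) (filter (\<lambda>k. 0 + height (take (Suc k) p) = int i) [0..<length p])"
      by (auto simp: e_def H_def len)
    then have "rev (map (fst \<circ> e) (pos i)) = ins 0 (int i) p" by (simp only: ins_eq_filter rev_map)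
    then show ?thesis by (metis rev_rev_ident)
  qed
  ultimately show ?thesis
    by (simp add: sw ks_def level_words_def level_word_def[abs_def] map_concat o_def del: upt_Suc)
qed

lemma length_sw: "length (sw n p) = 2 * n"
  by (simp add: sw_def)

section \<open>The zeta map by levels\<close>

text \<open>The area vector in terms of heights: the \<open>i\<close>-th North step ends at
  \<open>(b, i)\<close>, whose height \<open>i - b\<close> is the \<open>i\<close>-th entry.\<close>

fun ups :: "int \<Rightarrow> path \<Rightarrow> int list" where
  "ups c [] = []"
| "ups c (North # p) = (c + 1) # ups (c + 1) p"
| "ups c (East # p) = ups (c - 1) p"

lemma north_indices_Cons:
  "north_indices (s # p) = (if s = North then [0] else []) @ map Suc (north_indices p)"
proof -
  have "[0..<length (s # p)] = 0 # map Suc [0..<length p]"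
    by (simp add: map_Suc_upt upt_conv_Cons del: upt_Suc)
  then show ?thesis by (simp add: north_indices_def filter_map o_def del: upt_Suc)
qed

lemma length_north_indices: "length (north_indices p) = count_list p North"
  by (induction p) (auto simp: north_indices_Cons, simp add: north_indices_def)

lemma ups_eq:
  "map (\<lambda>j. c + int j + 1 - int (fst (position p (north_indices p ! j))))
     [0..<length (north_indices p)] = ups c p"
proof (induction p arbitrary: c)
  case Nil
  then show ?case by (simp add: north_indices_def)
next
  case (Cons s p)
  show ?case
  proof (cases s)
    case North
    have "[0..<length (north_indices (s # p))] = 0 # map Suc [0..<length (north_indices p)]"
      using North by (simp add: north_indices_Cons map_Suc_upt upt_conv_Cons del: upt_Suc)
    then show ?thesis
      using North
      by (auto simp: Cons[symmetric] north_indices_Cons position_eq simp del: upt_Suc)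
  next
    case East
    then show ?thesis
      by (auto simp: Cons[symmetric] north_indices_Cons position_eq)
  qed
qed

lemma area_vector_eq:
  assumes "p \<in> square_paths n"
  shows "area_vector n p = ups 0 p"
proof -
  have "count_list p North = n"
    using assms length_count[of p] by (auto simp: square_paths_iff height_count)
  moreover have "[1..<Suc n] = map Suc [0..<n]" by (simp add: map_Suc_upt)
  ultimately show ?thesis
    by (simp add: area_vector_def ups_eq[symmetric] length_north_indices o_def algebra_simps del: upt_Suc)
qed

text \<open>Below the diagonal an East step leaving height \<open>h\<close> is matched with the next North step
  returning to \<open>h\<close>; in between the path does not visit \<open>h\<close>. Above the diagonal an East step
  entering \<open>h\<close> is matched in the same way with the preceding North step leaving \<open>h\<close>.\<close>

lemma zeta_scan_outs:
  "c + height p \<ge> h \<Longrightarrow>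
     zeta_scan h (h + 1) (ups c p) = (if c < h then East # outs c h p else outs c h p)"
proof (induction p arbitrary: c)
  \<comment> \<open>For \<open>c < h\<close> the first arrival at \<open>h\<close> is drawn as
    \<open>East\<close> with no East step of \<open>p\<close> to match it, whence the extra
    letter.\<close>
  case (Cons s p)
  then show ?case by (cases s) (auto simp: add.assoc)
qed simp

lemma zeta_scan_ins:
  "c + height p \<le> h \<Longrightarrow>
     ins c h p = (if c > h then East # zeta_scan (h + 1) h (ups c p) else zeta_scan (h + 1) h (ups c p))"
proof (induction p arbitrary: c)
  case (Cons s p)
  then show ?case by (cases s) (auto simp: add.assoc)
qed simp

lemma zeta_scan_append: "zeta_scan e m (xs @ ys) = zeta_scan e m xs @ zeta_scan e m ys"
  by (induction xs) auto

lemma zeta_scan_rev: "zeta_scan e m (rev xs) = rev (zeta_scan e m xs)"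
  by (induction xs) (auto simp: zeta_scan_append)

lemma zeta_round_eq:
  assumes "height p = 0"
  shows "zeta_round (ups 0 p) (int i) = level_word p i"
  using zeta_scan_outs[of "- int i - 1" 0 p] zeta_scan_ins[of 0 p "int i"] assms
  by (simp add: zeta_round_def level_word_def zeta_scan_rev)

text \<open>If the loop stops before round 0, the length hypothesis forces the remaining words to be
  empty, so nothing is lost.\<close>

lemma while_zeta:
  assumes "height p = 0" "length (w @ level_words p 0 m) = N"
  shows "snd (while (\<lambda>(i, w). length w < N) (\<lambda>(i, w). (i - 1, w @ zeta_round (ups 0 p) i))
           (int m - 1, w)) = w @ level_words p 0 m"
  using assms(2)
proof (induction m arbitrary: w)
  case 0
  then show ?case by (subst while_unfold) (simp add: level_words_def)
next
  case (Suc m)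
  have split: "level_words p 0 (Suc m) = level_word p m @ level_words p 0 m"
    by (simp add: level_words_def)
  show ?case
  proof (cases "length w < N")
    case True
    then show ?thesis
      using Suc.IH[of "w @ level_word p m"] Suc.prems
      by (subst while_unfold) (simp add: split zeta_round_eq assms(1))
  next
    case False
    then have "level_words p 0 (Suc m) = []"
      using Suc.prems by (cases "level_words p 0 (Suc m)") auto
    with False show ?thesis by (subst while_unfold) simp
  qed
qed

text \<open>The length hypothesis will follow from \<open>length_sw\<close>, since the sweep map
  yields the same word.\<close>

lemma zeta_C_eq_level_words:
  assumes "p \<in> square_paths n" "length (level_words p 0 (Suc n)) = 2 * n"
  shows "zeta_C n p = level_words p 0 (Suc n)"
  using while_zeta[of p "[]" "Suc n" "2 * n"] assms
  by (simp add: zeta_C_def area_vector_eq square_paths_iff)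

section \<open>Counting crossings\<close>

lemma count_ins:
  "count_list (ins c h p) North = count_list (outs c (h - 1) p) North"
  "count_list (ins c h p) East = count_list (outs c (h + 1) p) East"
proof (induction p arbitrary: c)
  case (Cons s p)
  { case 1 then show ?case using Cons by (cases s) auto }
  { case 2 then show ?case using Cons by (cases s) auto }
qed auto

text \<open>Upward and downward crossings between \<open>h\<close> and \<open>h + 1\<close>
  alternate; the indicators record on which side the path starts and ends.\<close>

lemma count_crossings:
  "count_list (outs c h p) North + (if c > h then 1 else 0)
     = count_list (outs c (h + 1) p) East + (if c + height p > h then 1 else 0)"
proof (induction p arbitrary: c)
  case (Cons s p)
  show ?case using Cons[of "c + rise s"] by (cases s) (auto split: if_splits)
qed simp

definition crossings :: "path \<Rightarrow> int \<Rightarrow> nat" where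
  "crossings p h = count_list (outs 0 h p) North"

lemma count_level:
  assumes "height p = 0"
  shows "count_list (outs 0 h p) North = crossings p h"
    and "count_list (outs 0 h p) East = crossings p (h - 1)"
    and "count_list (ins 0 h p) North = crossings p (h - 1)"
    and "count_list (ins 0 h p) East = crossings p h"
  using count_crossings[of 0 "h - 1" p] count_crossings[of 0 h p] assms
  by (auto simp: crossings_def count_ins)

lemma outs_far:
  assumes "h > c + int (count_list p North) \<or> h < c - int (count_list p East)"
  shows "outs c h p = []"
  using assms
proof (induction p arbitrary: c)
  case (Cons s p)
  then show ?case by (cases s) auto
qed simp

lemma ins_far:
  assumes "h > c + int (count_list p North)"
  shows "ins c h p = []"
  using assms
proof (induction p arbitrary: c)
  case (Cons s p)
  then show ?case by (cases s) auto
qed simp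

lemma square_path_far:
  assumes "p \<in> square_paths n"
  shows "\<bar>h\<bar> > int n \<Longrightarrow> outs 0 h p = []" "h > int n \<Longrightarrow> ins 0 h p = []"
proof -
  have "count_list p North = n" "count_list p East = n"
    using assms length_count[of p] by (auto simp: square_paths_iff height_count)
  then show "\<bar>h\<bar> > int n \<Longrightarrow> outs 0 h p = []" "h > int n \<Longrightarrow> ins 0 h p = []"
    using outs_far[of 0 p h] ins_far[of 0 p h] by (auto simp: abs_if split: if_splits)
qed

lemma square_path_crossings:
  assumes "p \<in> square_paths n"
  shows "crossings p (int n) = 0" "crossings p (- int n - 2) = 0"
  using count_level(2)[of p "int n + 1"] count_level(1)[of p "- int n - 2"]
    square_path_far(1)[OF assms] assms by (auto simp: square_paths_iff)

section \<open>The image consists of ballot paths\<close>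

fun nonneg :: "int \<Rightarrow> path \<Rightarrow> bool" where
  "nonneg c [] \<longleftrightarrow> 0 \<le> c"
| "nonneg c (s # p) \<longleftrightarrow> 0 \<le> c \<and> nonneg (c + rise s) p"

lemma nonneg_iff: "nonneg c p \<longleftrightarrow> (\<forall>k\<le>length p. 0 \<le> c + height (take k p))"
proof (induction p arbitrary: c)
  case (Cons s p)
  have "(\<forall>k\<le>length (s # p). 0 \<le> c + height (take k (s # p)))
      \<longleftrightarrow> 0 \<le> c \<and> (\<forall>k\<le>length p. 0 \<le> c + height (take (Suc k) (s # p)))"
    by (auto simp: less_Suc_eq_le[symmetric] All_less_Suc2)
  then show ?case by (simp add: Cons add.assoc)
qed simp

lemma ballot_paths_iff: "p \<in> ballot_paths n \<longleftrightarrow> length p = 2 * n \<and> nonneg 0 p"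
  by (auto simp: ballot_paths_def nonneg_iff position_eq height_count)

lemma nonneg_append: "nonneg c p \<Longrightarrow> nonneg (c + height p) q \<Longrightarrow> nonneg c (p @ q)"
  by (induction p arbitrary: c) (auto simp: add.assoc)

lemma nonneg_if_few_East: "int (count_list p East) \<le> c \<Longrightarrow> nonneg c p"
proof (induction p arbitrary: c)
  case (Cons s p)
  then show ?case by (cases s) auto
qed simp

lemma height_rev [simp]: "height (rev p) = height p"
  by (induction p) auto

lemma nonneg_level_words:
  assumes "height p = 0"
  shows "nonneg (int (crossings p (int m - 1) + crossings p (- int m - 1))) (level_words p 0 m)"
proof (induction m)
  case 0
  then show ?case by (simp add: level_words_def)
next
  case (Suc m)
  let ?A = "outs 0 (- int m - 1) p" and ?B = "rev (ins 0 (int m) p)"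
  let ?c = "int (crossings p (int m) + crossings p (- 2 - int m))"
  have A: "height ?A = int (crossings p (- int m - 1)) - int (crossings p (- 2 - int m))"
    and B: "height ?B = int (crossings p (int m - 1)) - int (crossings p (int m))"
    using assms by (simp_all add: height_count[of "outs _ _ _"] height_count[of "ins _ _ _"] count_level)
  have "nonneg ?c ?A"
    using assms by (intro nonneg_if_few_East) (simp add: count_level)
  \<comment> \<open>The East steps of \<open>?A\<close> use up only the second summand of
    \<open>?c\<close>; the first pays for those of \<open>?B\<close>.\<close>
  moreover have "nonneg (?c + height ?A) ?B"
    unfolding A using assms by (intro nonneg_if_few_East) (simp add: count_level)
  moreover have "nonneg (?c + height ?A + height ?B) (level_words p 0 m)"
    using Suc unfolding A B by (simp add: algebra_simps)
  ultimately have "nonneg ?c (?A @ ?B @ level_words p 0 m)"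
    by (intro nonneg_append)
  moreover have "int (Suc m) - 1 = int m" "- int (Suc m) - 1 = - 2 - int m" by auto
  ultimately show ?case by (simp only: level_words_def) (simp add: level_word_def)
qed

lemma sw_in_ballot_paths:
  assumes "n \<ge> 1" "p \<in> square_paths n"
  shows "sw n p \<in> ballot_paths n"
proof -
  have "nonneg 0 (level_words p 0 (Suc n))"
    using square_path_crossings[OF assms(2)] nonneg_level_words[of p "Suc n"] assms(2) by (simp add: square_paths_iff algebra_simps)
  then show ?thesis
    using length_sw[of n p] by (simp add: ballot_paths_iff sw_eq_level_words[OF assms])
qed

section \<open>Injectivity\<close>

definition ends_North :: "path \<Rightarrow> bool" where
  "ends_North p \<longleftrightarrow> p = [] \<or> last p = North"

lemma ends_North_append: "ends_North p \<Longrightarrow> ends_North q \<Longrightarrow> ends_North (p @ q)"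
  by (cases "q = []") (auto simp: ends_North_def)

text \<open>If the cuts differed, the word between them would contain no North step and yet end with
  one.\<close>

lemma split_at_North:
  assumes "xs @ ys = xs' @ ys'" "count_list ys North = count_list ys' North"
    and "ends_North xs" "ends_North xs'"
  shows "xs = xs' \<and> ys = ys'"
proof -
  have *: "us = []" if "ends_North (zs @ us)" "count_list us North = 0" for us zs
  proof (rule ccontr)
    assume "us \<noteq> []"
    then have "North \<in> set us" using that(1) last_in_set[of us] by (auto simp: ends_North_def)
    then show False using that(2) by (simp add: count_list_0_iff)
  qed
  from assms(1) obtain us where "xs = xs' @ us \<and> us @ ys = ys' \<or> xs @ us = xs' \<and> ys = us @ ys'"
    by (auto simp: append_eq_append_conv2)
  then show ?thesis
  proof
    assume "xs = xs' @ us \<and> us @ ys = ys'"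
    then show ?thesis using *[of xs' us] assms by auto
  next
    assume "xs @ us = xs' \<and> ys = us @ ys'"
    then show ?thesis using *[of xs us] assms by auto
  qed
qed

text \<open>The last departure from \<open>h\<close> must go up, since a path going down has to pass
  \<open>h\<close> again to end above it.\<close>

lemma ends_North_outs: "c + height p > h \<Longrightarrow> ends_North (outs c h p)"
proof (induction p arbitrary: c)
  case (Cons s p)
  have "outs (h - 1) h p \<noteq> []" if "h - 1 + height p > h"
    using count_crossings[of "h - 1" h p] count_crossings[of "h - 1" "h - 1" p] that
    by (auto split: if_splits)
  then show ?case
    using Cons.prems Cons.IH[of "c + rise s"] by (cases s) (auto simp: ends_North_def add.assoc)
qed (simp add: ends_North_def)

lemma ins_from_below: "c < h \<Longrightarrow> ins c h p = [] \<or> hd (ins c h p) = North"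
proof (induction p arbitrary: c)
  case (Cons s p)
  then show ?case by (cases s) auto
qed simp

lemma ins_from_above: "c + height p \<le> h \<Longrightarrow> h < c \<Longrightarrow> ins c h p \<noteq> [] \<and> hd (ins c h p) = East"
  by (simp add: zeta_scan_ins)

text \<open>Level 0 is excluded: the path may first return to height 0 by an East step, which is
  then read last.\<close>

lemma ends_North_level_words:
  assumes "height p = 0" "i \<ge> 1"
  shows "ends_North (level_words p i m)"
proof -
  have "ends_North (level_word p j)" if "j \<ge> 1" for j
    unfolding level_word_def
  proof (intro ends_North_append)
    show "ends_North (outs 0 (- int j - 1) p)" using assms by (intro ends_North_outs) simp
    show "ends_North (rev (ins 0 (int j) p))"
      using ins_from_below[of 0 "int j" p] that by (auto simp: ends_North_def last_rev)
  qed
  then have "\<forall>j\<in>set js. j \<ge> 1 \<Longrightarrow> ends_North (concat (map (level_word p) js))" for js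
    by (induction js) (auto intro: ends_North_append simp: ends_North_def[of "[]"])
  then show ?thesis using assms(2) by (auto simp: level_words_def)
qed

text \<open>The heights of the blocks telescope. At \<open>m = Suc n\<close> the boundary terms
  vanish for square paths, so the final height reveals \<open>crossings p (- 1)\<close>.\<close>

lemma height_level_words:
  assumes "height p = 0"
  shows "height (level_words p 0 m)
    = 2 * int (crossings p (- 1)) - int (crossings p (int m - 1)) - int (crossings p (- int m - 1))"
proof (induction m)
  case (Suc m)
  then show ?case using assms
    by (simp add: level_words_def level_word_def height_count count_level algebra_simps)
qed (simp add: level_words_def)

text \<open>At the first difference of two paths at height \<open>c \<ge> 0\<close>, the one going up next enters \<open>c\<close> by an
  East step, whereas the one going down next enters \<open>c\<close> by a North step, if at all.\<close>

lemma paths_eq_if_levels_eq: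
  assumes "\<And>h. h < 0 \<Longrightarrow> outs c h p = outs c h q" "\<And>h. 0 \<le> h \<Longrightarrow> ins c h p = ins c h q"
    and "length p = length q" "c + height p = 0" "c + height q = 0"
  shows "p = q"
  using assms
proof (induction p arbitrary: c q)
  case (Cons s p)
  then obtain t q' where q: "q = t # q'" by (cases q) auto
  have "s = t"
  proof (cases "c < 0")
    case True
    \<comment> \<open>At a negative height the next step is itself the first letter of
      \<open>outs c c\<close>.\<close>
    then show ?thesis using Cons.prems(1)[of c] by (simp add: q)
  next
    case False
    have *: False if "ins (c + 1) c u = ins (c - 1) c v" "c + 1 + height u = 0" for u v
      using ins_from_above[of "c + 1" u c] ins_from_below[of "c - 1" c v] that False by auto
    show ?thesis
      using Cons.prems(2)[of c] Cons.prems(4,5) False *[of p q'] *[of q' p]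
      by (cases s; cases t) (auto simp: q)
  qed
  moreover have "p = q'"
  proof (rule Cons.IH)
    show "outs (c + rise s) h p = outs (c + rise s) h q'" if "h < 0" for h
      using Cons.prems(1)[OF that] \<open>s = t\<close> by (simp add: q)
    show "ins (c + rise s) h p = ins (c + rise s) h q'" if "0 \<le> h" for h
      using Cons.prems(2)[OF that] \<open>s = t\<close> by (simp add: q split: if_splits)
  qed (use Cons.prems \<open>s = t\<close> in \<open>auto simp: q\<close>)
  ultimately show ?case by (simp add: q)
qed simp

lemma level_words_inj:
  assumes p: "p \<in> square_paths n" and q: "q \<in> square_paths n"
    and eq: "level_words p 0 (Suc n) = level_words q 0 (Suc n)"
  shows "p = q"
proof -
  have hp: "height p = 0" and hq: "height q = 0" and len: "length p = length q"
    using p q by (auto simp: square_paths_iff)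
  have start: "crossings p (- 1) = crossings q (- 1)"
    using height_level_words[OF hp, of "Suc n"] height_level_words[OF hq, of "Suc n"] eq
      square_path_crossings[OF p] square_path_crossings[OF q] by (simp add: algebra_simps)
  have split: "level_words r i (Suc n)
      = (level_words r (Suc i) (Suc n) @ outs 0 (- int i - 1) r) @ rev (ins 0 (int i) r)"
    if "i \<le> n" for r i
    using that by (simp add: level_words_def level_word_def upt_conv_Cons del: upt_Suc)
  have peel: "ins 0 (int i) p = ins 0 (int i) q \<and> outs 0 (- int i - 1) p = outs 0 (- int i - 1) q
      \<and> level_words p (Suc i) (Suc n) = level_words q (Suc i) (Suc n)"
    if "i \<le> n" "level_words p i (Suc n) = level_words q i (Suc n)"
      "crossings p (int i - 1) = crossings q (int i - 1)"
      "crossings p (- int i - 1) = crossings q (- int i - 1)" for i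
  proof -
    have en: "ends_North (level_words r (Suc i) (Suc n))" "ends_North (outs 0 (- int i - 1) r)"
      if "height r = 0" for r
      using that ends_North_level_words[of r "Suc i"] ends_North_outs[of "- int i - 1" 0 r] by auto
    have 1: "level_words p (Suc i) (Suc n) @ outs 0 (- int i - 1) p
        = level_words q (Suc i) (Suc n) @ outs 0 (- int i - 1) q
      \<and> rev (ins 0 (int i) p) = rev (ins 0 (int i) q)"
      using that en[OF hp] en[OF hq]
      by (intro split_at_North) (auto simp: split count_level hp hq intro: ends_North_append)
    then have "level_words p (Suc i) (Suc n) = level_words q (Suc i) (Suc n)
      \<and> outs 0 (- int i - 1) p = outs 0 (- int i - 1) q"
      using that en[OF hp] en[OF hq] by (intro split_at_North) (auto simp: count_level hp hq)
    with 1 show ?thesis by simp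
  qed
  have inv: "i \<le> Suc n \<Longrightarrow> level_words p i (Suc n) = level_words q i (Suc n)
      \<and> crossings p (int i - 1) = crossings q (int i - 1)
      \<and> crossings p (- int i - 1) = crossings q (- int i - 1)" for i
  proof (induction i)
    case 0
    then show ?case using eq start by simp
  next
    case (Suc i)
    then have "ins 0 (int i) p = ins 0 (int i) q" "outs 0 (- int i - 1) p = outs 0 (- int i - 1) q"
      "level_words p (Suc i) (Suc n) = level_words q (Suc i) (Suc n)"
      using peel[of i] by auto
    \<comment> \<open>The East steps of the two recovered words give the crossing numbers that
      locate the cuts at the next level.\<close>
    then show ?case
      using count_level(4)[OF hp, of "int i"] count_level(4)[OF hq, of "int i"]
        count_level(2)[OF hp, of "- int i - 1"] count_level(2)[OF hq, of "- int i - 1"]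
      by (simp add: algebra_simps)
  qed
  have blocks: "ins 0 (int i) p = ins 0 (int i) q \<and> outs 0 (- int i - 1) p = outs 0 (- int i - 1) q" for i
    using peel[of i] inv[of i] square_path_far[OF p] square_path_far[OF q] by (cases "i \<le> n") auto
  show ?thesis
  proof (rule paths_eq_if_levels_eq[of 0])
    show "outs 0 h p = outs 0 h q" if "h < 0" for h
      using blocks[of "nat (- h - 1)"] that by simp
    show "ins 0 h p = ins 0 h q" if "0 \<le> h" for h
      using blocks[of "nat h"] that by simp
  qed (use hp hq len in auto)
qed

section \<open>Ballot paths and square paths are equinumerous\<close>

lemma finite_paths: "finite {p :: path. length p = m \<and> P p}"
proof -
  have "UNIV = {North, East}" using step.exhaust by auto
  then have "finite (UNIV :: step set)" by (metis finite.simps)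
  then have "finite {p :: path. length p = m}" using finite_lists_length_eq[of UNIV m] by simp
  then show ?thesis by (rule rev_finite_subset) auto
qed

lemma card_paths_Suc:
  "card {p :: path. length p = Suc m \<and> P p}
     = card {p. length p = m \<and> P (North # p)} + card {p. length p = m \<and> P (East # p)}"
proof -
  have "{p :: path. length p = Suc m \<and> P p}
      = (#) North ` {p. length p = m \<and> P (North # p)} \<union> (#) East ` {p. length p = m \<and> P (East # p)}"
    (is "_ = ?A \<union> ?B")
  proof (intro set_eqI iffI)
    fix p :: path assume "p \<in> {p. length p = Suc m \<and> P p}"
    then obtain s q where "p = s # q" "length q = m" "P (s # q)" by (auto simp: length_Suc_conv)
    then show "p \<in> ?A \<union> ?B" by (cases s) auto
  qed auto
  moreover have "card (?A \<union> ?B) = card ?A + card ?B"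
    by (intro card_Un_disjoint) (auto intro: finite_paths)
  ultimately show ?thesis by (simp add: card_image)
qed

text \<open>A closed form of the reflection principle: summing over all endpoints, the paths staying
  at or above \<open>-c\<close> are as many as those ending in the window \<open>[-c, c + 1]\<close>. Both counts satisfy the
  same recurrence, the windows for \<open>c + 1\<close> and \<open>c - 1\<close> being the union and the intersection of
  the two shifts of the window for \<open>c\<close>.\<close>

lemma card_nonneg_paths:
  "- 1 \<le> c \<Longrightarrow> card {p. length p = m \<and> nonneg c p}
     = card {p. length p = m \<and> height p \<in> {- c..c + 1}}"
proof (induction m arbitrary: c)
  case 0
  have "{p. length p = 0 \<and> nonneg c p} = {p. length p = 0 \<and> height p \<in> {- c..c + 1}}" by auto
  then show ?case by simp
next
  case (Suc m)
  let ?V = "\<lambda>a b. {p. length p = m \<and> height p \<in> {a..b}}"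
  show ?case
  proof (cases "c = - 1")
    case True
    \<comment> \<open>Here the window \<open>[1, 0]\<close> is empty; the case serves the recurrence
      at \<open>c = 0\<close>.\<close>
    then have "\<not> nonneg c p" for p by (cases p) auto
    with True show ?thesis by simp
  next
    case False
    with Suc.prems have c: "0 \<le> c" by simp
    have "card {p. length p = Suc m \<and> nonneg c p}
        = card {p. length p = m \<and> nonneg (c + 1) p} + card {p. length p = m \<and> nonneg (c - 1) p}"
      using c by (simp add: card_paths_Suc)
    also have "\<dots> = card (?V (- c - 1) (c + 2)) + card (?V (- c + 1) c)"
    proof -
      have "- 1 \<le> c + 1" "- 1 \<le> c - 1" using c by auto
      moreover have "- (c + 1) = - c - 1" "c + 1 + 1 = c + 2" "- (c - 1) = - c + 1" "c - 1 + 1 = c" by auto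
      ultimately show ?thesis by (simp only: Suc.IH)
    qed
    also have "?V (- c - 1) (c + 2) = ?V (- c - 1) c \<union> ?V (- c + 1) (c + 2)" using c by auto
    also have "?V (- c + 1) c = ?V (- c - 1) c \<inter> ?V (- c + 1) (c + 2)" using c by auto
    also have "card (?V (- c - 1) c \<union> ?V (- c + 1) (c + 2)) + card (?V (- c - 1) c \<inter> ?V (- c + 1) (c + 2))
        = card (?V (- c - 1) c) + card (?V (- c + 1) (c + 2))"
      by (intro card_Un_Int[symmetric] finite_paths)
    also have "?V (- c - 1) c = {p. length p = m \<and> height (North # p) \<in> {- c..c + 1}}" by auto
    also have "?V (- c + 1) (c + 2) = {p. length p = m \<and> height (East # p) \<in> {- c..c + 1}}" by auto
    finally show ?thesis by (simp only: card_paths_Suc)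
  qed
qed

text \<open>For \<open>c = 0\<close> the window is \<open>[0, 1]\<close>, and a path of even length
  has even height.\<close>

lemma card_ballot_paths: "card (ballot_paths n) = card (square_paths n)"
proof -
  have "height p \<noteq> 1" if "length p = 2 * n" for p
    using that length_count[of p] by (simp add: height_count) presburger
  then have "{p. length p = 2 * n \<and> height p \<in> {- 0..0 + 1}} = square_paths n"
    by (force simp: square_paths_iff)
  moreover have "ballot_paths n = {p. length p = 2 * n \<and> nonneg 0 p}"
    by (auto simp: ballot_paths_iff)
  ultimately show ?thesis using card_nonneg_paths[of 0 "2 * n"] by simp
qed

theorem theorem4p4:
  fixes n :: nat
  assumes "n \<ge> 1"
  shows "(\<forall>p \<in> square_paths n. sw n p = zeta_C n p)
         \<and> bij_betw (sw n) (square_paths n) (ballot_paths n)"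
proof
  show "\<forall>p \<in> square_paths n. sw n p = zeta_C n p"
  proof
    fix p assume p: "p \<in> square_paths n"
    then show "sw n p = zeta_C n p"
      using sw_eq_level_words[OF assms p] length_sw[of n p] zeta_C_eq_level_words[OF p] by simp
  qed
  have inj: "inj_on (sw n) (square_paths n)"
    using sw_eq_level_words[OF assms] level_words_inj by (intro inj_onI) metis
  have "finite (ballot_paths n)"
    unfolding ballot_paths_def by (rule finite_paths)
  then have "sw n ` square_paths n = ballot_paths n"
    using sw_in_ballot_paths[OF assms] card_image[OF inj] card_ballot_paths[of n]
    by (intro card_subset_eq) auto
  with inj show "bij_betw (sw n) (square_paths n) (ballot_paths n)"
    by (simp add: bij_betw_def)
qed

end
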